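(* Let $p\in(0,1)$, $\rho\in(0,1)$ and $a\in(0,1]$. Let $L_n$ be the number of defaults in the homogeneous single-factor normal copula portfolio with $n$ obligors, marginal default probability $p$ and factor loading $\rho$. Let $(q_n)_{n\ge1}$ be a sequence with $q_n<1$, $q_n\nearrow 1$ as $n\to\infty$, and $1-q_n$ of exact order $n^{-a}$, i.e. there are constants $0<c\le C<\infty$ such that $c\,n^{-a}\le 1-q_n\le C\,n^{-a}$ for all sufficiently large $n$. Then $$\lim_{n\to\infty}\frac{1}{\ln n}\ln\mathbb{P}[L_n\ge n q_n] = -a\,\frac{1-\rho^2}{\rho^2}.$$
   Context: Homogeneous single-factor normal copula model: let $Z,\varepsilon_1,\varepsilon_2,\ldots$ be independent standard normal random variables, and set $$X_k=\rho Z+\sqrt{1-\rho^2}\,\varepsilon_k,\qquad k\ge 1.$$ The default indicator of obligor $k$ is $Y_k=1_{\{X_k>-\Phi^{-1}(p)\}}$, where $\Phi$ is the standard normal cumulative distribution function, so that $\mathbb{P}[Y_k=1]=p$. Each default causes a loss equal to $1$, and the total loss is $L_n=Y_1+\cdots+Y_n$. *)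

theory Defs
  imports "HOL-Probability.Probability"
begin

definition Phi :: "real \<Rightarrow> real" where
  "Phi = cdf std_normal_distribution"

(* Phi is a bijection from the reals onto (0,1), so this is its inverse there; the value is
   unspecified for p outside (0,1). *)
definition Phi_inv :: "real \<Rightarrow> real" where
  "Phi_inv p = (THE x. Phi x = p)"

definition copula_X :: "real \<Rightarrow> ('a \<Rightarrow> real) \<Rightarrow> (nat \<Rightarrow> 'a \<Rightarrow> real) \<Rightarrow> nat \<Rightarrow> 'a \<Rightarrow> real" where
  "copula_X \<rho> Z \<epsilon> k \<omega> = \<rho> * Z \<omega> + sqrt (1 - \<rho>\<^sup>2) * \<epsilon> k \<omega>"

definition default_indicator ::
    "real \<Rightarrow> real \<Rightarrow> ('a \<Rightarrow> real) \<Rightarrow> (nat \<Rightarrow> 'a \<Rightarrow> real) \<Rightarrow> nat \<Rightarrow> 'a \<Rightarrow> real" where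
  "default_indicator p \<rho> Z \<epsilon> k \<omega> = of_bool (copula_X \<rho> Z \<epsilon> k \<omega> > - Phi_inv p)"

definition total_loss ::
    "real \<Rightarrow> real \<Rightarrow> ('a \<Rightarrow> real) \<Rightarrow> (nat \<Rightarrow> 'a \<Rightarrow> real) \<Rightarrow> nat \<Rightarrow> 'a \<Rightarrow> real" where
  "total_loss p \<rho> Z \<epsilon> n \<omega> = (\<Sum>k=1..n. default_indicator p \<rho> Z \<epsilon> k \<omega>)"

(* Independence is that of the single family Z, \<epsilon> 1, \<epsilon> 2, ...: index 0 stands for the
   common factor Z, and the value \<epsilon> 0 is never used. *)
definition factor_family ::
    "'a measure \<Rightarrow> ('a \<Rightarrow> real) \<Rightarrow> (nat \<Rightarrow> 'a \<Rightarrow> real) \<Rightarrow> bool" where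
  "factor_family M Z \<epsilon> \<longleftrightarrow>
     prob_space.indep_vars M (\<lambda>_. borel) (\<lambda>k. if k = 0 then Z else \<epsilon> k) (UNIV :: nat set) \<and>
     distributed M lborel Z std_normal_density \<and>
     (\<forall>k\<ge>1. distributed M lborel (\<epsilon> k) std_normal_density)"

end

theory Submission imports Defs "HOL-Real_Asymp.Real_Asymp" begin

text \<open>
  Almost all obligors default, within a tolerance of order \<open>n powr (1 - a)\<close> survivors, essentially
  only when the common factor \<open>Z\<close> is large. Write \<open>\<sigma> = sqrt (1 - \<rho>\<^sup>2)\<close> and \<open>c = Phi_inv p\<close>. Given
  \<open>Z = z\<close>, an obligor survives with probability \<open>Phi (- t)\<close>, where \<open>\<rho> z = \<sigma> t - c\<close>. The tolerated
  proportion of survivors is \<open>d = 1 - q n\<close>, of order \<open>n powr (- a)\<close>, so the cost of the event should be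
  the cost of reaching the level \<open>z\<close> at which \<open>Phi (- t)\<close> is about \<open>n powr (- a)\<close>.

  The exponent then comes from the Gaussian tail alone: \<open>ln (Phi (- t))\<close> behaves like \<open>- t\<^sup>2 / 2\<close>
  (\<open>ln_Phi_lower_tail\<close>), so \<open>t\<^sup>2\<close> is about \<open>2 a ln n\<close>, while \<open>z\<close> is about \<open>(\<sigma> / \<rho>) t\<close>; hence
  \<open>ln P(Z \<ge> z)\<close> is about \<open>- (\<sigma> / \<rho>)\<^sup>2 a ln n\<close>. Only the logarithmic order of \<open>Phi (- t)\<close> matters
  here (\<open>ln_rate_Phi_affine_quantile\<close>), which leaves room to choose different levels for
  the two bounds.

  Lower bound: take \<open>Phi (- t) = d / 2\<close>. On \<open>{Z \<ge> z}\<close> every survivor has \<open>\<epsilon> k \<le> - t\<close>, and the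
  expected number of such indices is half of the tolerance, so by Markov's inequality the tolerance
  is respected with conditional probability at least \<open>1 / 2\<close> (\<open>prob_few_occurrences_ge\<close>).

  Upper bound: take \<open>Phi (- t) = n powr (- a) * (ln n)\<^sup>2\<close>. On \<open>{Z < z}\<close> every index with
  \<open>\<epsilon> k \<le> - t\<close> is a survivor, and their expected number exceeds the tolerance by a factor of order
  \<open>(ln n)\<^sup>2\<close>. By a Chernoff bound (\<open>prob_few_occurrences_le\<close>), the probability that their number
  stays within the tolerance decays faster than every power of \<open>n\<close>, since \<open>a \<le> 1\<close>; this is
  negligible against \<open>P(Z \<ge> z)\<close>.

  Both bounds compare \<open>Z\<close> with a single level and use that \<open>copula_X\<close> is monotone in \<open>Z\<close>; this replaces
  conditioning on \<open>Z\<close>.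
\<close>

section \<open>Tails of the standard normal distribution\<close>

lemma Phi_eq_prob:
  assumes "prob_space M" "distributed M lborel X std_normal_density"
  shows "measure M {\<omega> \<in> space M. X \<omega> \<le> s} = Phi s"
proof -
  have X [measurable]: "X \<in> borel_measurable M"
    using distributed_measurable[OF assms(2)] by simp
  have "Phi s = measure (distr M lborel X) {..s}"
    unfolding Phi_def cdf_def distributed_distr_eq_density[OF assms(2)] ..
  also have "\<dots> = measure M (X -` {..s} \<inter> space M)"
    by (subst measure_distr) auto
  also have "X -` {..s} \<inter> space M = {\<omega> \<in> space M. X \<omega> \<le> s}" by auto
  finally show ?thesis ..
qed

lemma Phi_minus_eq_prob:
  assumes "prob_space M" "distributed M lborel X std_normal_density"
  shows "measure M {\<omega> \<in> space M. s \<le> X \<omega>} = Phi (- s)"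
proof -
  have "distributed M lborel (\<lambda>\<omega>. - X \<omega>) std_normal_density"
    using prob_space.normal_density_affine[OF assms(1), of X 0 1 "-1" 0] assms(2) by simp
  from Phi_eq_prob[OF assms(1) this, of "- s"] show ?thesis by simp
qed

text \<open>
  On the half-line \<open>x \<le> - t\<close> the density is at most \<open>exp (- t\<^sup>2 / 2)\<close> times its translate
  centred at \<open>- t\<close>, which has total mass \<open>1\<close>.
\<close>

lemma Phi_lower_tail_le:
  assumes "0 \<le> t"
  shows "Phi (- t) \<le> exp (- t\<^sup>2 / 2)"
proof -
  interpret real_distribution std_normal_distribution by (rule real_dist_normal_dist)
  have le: "ennreal (std_normal_density x) * indicator {..- t} x
      \<le> ennreal (exp (- t\<^sup>2 / 2)) * ennreal (std_normal_density (t + 1 * x))" for x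
  proof (cases "x \<le> - t")
    case True
    \<comment> \<open>The cross term of \<open>x\<^sup>2 = (t + x)\<^sup>2 + t\<^sup>2 - 2 t (t + x)\<close> has the good sign.\<close>
    have "t * (t + x) \<le> 0" using True assms by (simp add: mult_nonneg_nonpos)
    hence "- x\<^sup>2 / 2 \<le> - t\<^sup>2 / 2 + - (t + x)\<^sup>2 / 2"
      by (simp add: power2_eq_square algebra_simps)
    hence "exp (- x\<^sup>2 / 2) \<le> exp (- t\<^sup>2 / 2) * exp (- (t + x)\<^sup>2 / 2)"
      by (simp flip: exp_add)
    thus ?thesis using True
      by (auto simp: std_normal_density_def ennreal_mult[symmetric] divide_right_mono intro!: ennreal_leI)
  qed auto
  have "emeasure std_normal_distribution {..- t}
      = (\<integral>\<^sup>+x. ennreal (std_normal_density x) * indicator {..- t} x \<partial>lborel)"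
    by (subst emeasure_density) auto
  also have "\<dots> \<le> (\<integral>\<^sup>+x. ennreal (exp (- t\<^sup>2 / 2)) * ennreal (std_normal_density (t + 1 * x)) \<partial>lborel)"
    by (rule nn_integral_mono) (use le in simp)
  also have "\<dots> = ennreal (exp (- t\<^sup>2 / 2)) * (\<integral>\<^sup>+x. ennreal (std_normal_density (t + 1 * x)) \<partial>lborel)"
    by (rule nn_integral_cmult) measurable
  also have "(\<integral>\<^sup>+x. ennreal (std_normal_density (t + 1 * x)) \<partial>lborel)
      = (\<integral>\<^sup>+x. ennreal (std_normal_density x) \<partial>lborel)"
    by (subst nn_integral_real_affine[where c = 1 and t = t, of "\<lambda>x. ennreal (std_normal_density x)"]) auto
  also have "\<dots> = 1"
    using emeasure_space_1 by (simp add: emeasure_density)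
  finally show ?thesis
    unfolding Phi_def cdf_def by (simp add: emeasure_eq_measure)
qed

text \<open>
  The unit interval \<open>{- t - 1..- t}\<close> already carries this much mass; the loss of \<open>t + 1\<close> against
  \<open>t\<close> in the exponent vanishes after division by \<open>t\<^sup>2\<close>.
\<close>

lemma Phi_lower_tail_ge:
  assumes "0 \<le> t"
  shows "exp (- (t + 1)\<^sup>2 / 2) / sqrt (2 * pi) \<le> Phi (- t)"
proof -
  interpret real_distribution std_normal_distribution by (rule real_dist_normal_dist)
  let ?m = "exp (- (t + 1)\<^sup>2 / 2) / sqrt (2 * pi)"
  have le: "ennreal ?m * indicator {- t - 1..- t} x
      \<le> ennreal (std_normal_density x) * indicator {..- t} x" for x
  proof (cases "x \<in> {- t - 1..- t}")
    case True
    hence "\<bar>x\<bar> \<le> \<bar>t + 1\<bar>" using assms by auto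
    hence "x\<^sup>2 \<le> (t + 1)\<^sup>2" by (simp only: abs_le_square_iff)
    thus ?thesis using True
      by (auto simp: std_normal_density_def divide_right_mono intro!: ennreal_leI)
  qed auto
  have "ennreal ?m = ennreal ?m * emeasure lborel {- t - 1..- t}" by simp
  also have "\<dots> = (\<integral>\<^sup>+x. ennreal ?m * indicator {- t - 1..- t} x \<partial>lborel)"
    by (rule nn_integral_cmult_indicator[symmetric]) simp
  also have "\<dots> \<le> (\<integral>\<^sup>+x. ennreal (std_normal_density x) * indicator {..- t} x \<partial>lborel)"
    by (rule nn_integral_mono) (use le in simp)
  also have "\<dots> = emeasure std_normal_distribution {..- t}"
    by (subst emeasure_density) auto
  finally show ?thesis
    unfolding Phi_def cdf_def by (simp add: emeasure_eq_measure)
qed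

lemma Phi_mono: "x \<le> y \<Longrightarrow> Phi x \<le> Phi y"
proof -
  interpret real_distribution std_normal_distribution by (rule real_dist_normal_dist)
  show "x \<le> y \<Longrightarrow> Phi x \<le> Phi y" unfolding Phi_def by (rule cdf_nondecreasing)
qed

lemma Phi_pos: "0 < Phi x"
proof -
  have "0 < exp (- (\<bar>x\<bar> + 1)\<^sup>2 / 2) / sqrt (2 * pi)" by simp
  also have "\<dots> \<le> Phi (- \<bar>x\<bar>)" by (rule Phi_lower_tail_ge) simp
  also have "\<dots> \<le> Phi x" by (rule Phi_mono) simp
  finally show ?thesis .
qed

lemma Phi_surj:
  assumes "0 < u" "u < 1"
  obtains x where "Phi x = u"
proof -
  interpret real_distribution std_normal_distribution by (rule real_dist_normal_dist)
  have "isCont (cdf std_normal_distribution) x" for x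
  proof -
    have "emeasure std_normal_distribution {x} = 0"
      by (subst emeasure_density) (auto simp: nn_integral_indicator_singleton)
    thus ?thesis unfolding isCont_cdf by (simp add: emeasure_eq_measure)
  qed
  hence cont: "continuous_on UNIV Phi"
    unfolding Phi_def by (simp add: continuous_at_imp_continuous_on)
  have "\<forall>\<^sub>F x in at_bot. Phi x < u"
    unfolding Phi_def using order_tendstoD(2)[OF cdf_lim_at_bot] assms by blast
  then obtain l where l: "Phi l < u" by (auto simp: eventually_at_bot_linorder)
  have "\<forall>\<^sub>F x in at_top. u < Phi x"
    unfolding Phi_def using order_tendstoD(1)[OF cdf_lim_at_top_prob] assms by blast
  then obtain h where h: "u < Phi h" by (auto simp: eventually_at_top_linorder)
  have "l \<le> h" using l h Phi_mono[of h l] by (cases "l \<le> h") auto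
  then obtain x where "Phi x = u"
    using IVT'[of Phi l u h] l h continuous_on_subset[OF cont] by auto
  thus ?thesis by (rule that)
qed

lemma ln_Phi_lower_tail:
  "((\<lambda>t. ln (Phi (- t)) / t\<^sup>2) \<longlongrightarrow> - 1 / 2) at_top"
proof (rule tendsto_sandwich)
  show "\<forall>\<^sub>F t in at_top. (- (t + 1)\<^sup>2 / 2 - ln (sqrt (2 * pi))) / t\<^sup>2 \<le> ln (Phi (- t)) / t\<^sup>2"
    using eventually_ge_at_top[of 0]
  proof eventually_elim
    case (elim t)
    have "ln (exp (- (t + 1)\<^sup>2 / 2) / sqrt (2 * pi)) \<le> ln (Phi (- t))"
      using Phi_lower_tail_ge[OF elim] Phi_pos[of "- t"] by (subst ln_le_cancel_iff) auto
    hence "- (t + 1)\<^sup>2 / 2 - ln (sqrt (2 * pi)) \<le> ln (Phi (- t))"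
      by (subst (asm) ln_div) auto
    thus ?case by (rule divide_right_mono) simp
  qed
  show "\<forall>\<^sub>F t in at_top. ln (Phi (- t)) / t\<^sup>2 \<le> (- t\<^sup>2 / 2) / t\<^sup>2"
    using eventually_ge_at_top[of 0]
  proof eventually_elim
    case (elim t)
    have "ln (Phi (- t)) \<le> ln (exp (- t\<^sup>2 / 2))"
      using Phi_lower_tail_le[OF elim] Phi_pos[of "- t"] by (subst ln_le_cancel_iff) auto
    thus ?case by (intro divide_right_mono) auto
  qed
  show "((\<lambda>t::real. (- (t + 1)\<^sup>2 / 2 - ln (sqrt (2 * pi))) / t\<^sup>2) \<longlongrightarrow> - 1 / 2) at_top"
    by real_asymp
  show "((\<lambda>t::real. (- t\<^sup>2 / 2) / t\<^sup>2) \<longlongrightarrow> - 1 / 2) at_top"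
    by real_asymp
qed

section \<open>Logarithmic rates\<close>

text \<open>
  The limit of \<open>ln (f n) / ln n\<close> ignores constant factors, which absorbs the factor \<open>1 / 2\<close> lost to
  Markov's inequality and the factor \<open>2\<close> lost to the union bound.
\<close>

lemma ln_rate_cmult:
  fixes f :: "nat \<Rightarrow> real"
  assumes "0 < K" "\<forall>\<^sub>F n in sequentially. 0 < f n"
    and "(\<lambda>n. ln (f n) / ln (real n)) \<longlonglongrightarrow> L"
  shows "(\<lambda>n. ln (K * f n) / ln (real n)) \<longlonglongrightarrow> L"
proof -
  have "(\<lambda>n. ln K / ln (real n)) \<longlonglongrightarrow> 0" by real_asymp
  from tendsto_add[OF this assms(3)]
  have "(\<lambda>n. ln K / ln (real n) + ln (f n) / ln (real n)) \<longlonglongrightarrow> L" by simp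
  moreover have "\<forall>\<^sub>F n in sequentially.
      ln K / ln (real n) + ln (f n) / ln (real n) = ln (K * f n) / ln (real n)"
    using assms(2) by eventually_elim (use assms(1) in \<open>simp add: ln_mult add_divide_distrib\<close>)
  ultimately show ?thesis by (rule Lim_transform_eventually)
qed

text \<open>
  If \<open>t\<close> is the quantile at which the lower tail equals \<open>u\<close>, then \<open>t\<^sup>2\<close> is asymptotically
  \<open>2 a ln n\<close>. An affine change \<open>r * t - b\<close> multiplies the square by \<open>r\<^sup>2\<close> to leading order, and
  hence also the rate of the tail. In the portfolio, \<open>r = sqrt (1 - \<rho>\<^sup>2) / \<rho>\<close> translates the level
  of the idiosyncratic terms to the level of the common factor.
\<close>

lemma ln_rate_Phi_affine_quantile:
  fixes u :: "nat \<Rightarrow> real"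
  assumes u: "\<forall>\<^sub>F n in sequentially. 0 < u n \<and> u n < 1"
    and rate: "(\<lambda>n. ln (u n) / ln (real n)) \<longlonglongrightarrow> - a" and "0 < a" "0 < r"
  obtains t where "\<forall>\<^sub>F n in sequentially. Phi (- t n) = u n"
    and "(\<lambda>n. ln (Phi (- (r * t n - b))) / ln (real n)) \<longlonglongrightarrow> - a * r\<^sup>2"
proof -
  define t where "t n = (SOME x. Phi (- x) = u n)" for n
  have t: "\<forall>\<^sub>F n in sequentially. Phi (- t n) = u n"
    using u
  proof eventually_elim
    case (elim n)
    then obtain x where "Phi x = u n" using Phi_surj by blast
    hence "Phi (- (- x)) = u n" by simp
    thus ?case unfolding t_def by (rule someI)
  qed
  have ln_top: "filterlim (\<lambda>n. ln (real n)) at_top sequentially" by real_asymp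
  have "filterlim (\<lambda>n. (ln (u n) / ln (real n)) * ln (real n)) at_bot sequentially"
    by (rule filterlim_tendsto_neg_mult_at_bot[OF rate _ ln_top]) (use \<open>0 < a\<close> in simp)
  moreover have "\<forall>\<^sub>F n in sequentially. (ln (u n) / ln (real n)) * ln (real n) = ln (u n)"
    using eventually_gt_at_top[of 1] by eventually_elim simp
  ultimately have ln_u: "filterlim (\<lambda>n. ln (u n)) at_bot sequentially"
    by (simp cong: filterlim_cong)
  have t_top: "filterlim t at_top sequentially"
    unfolding filterlim_at_top
  proof
    fix K
    have "\<forall>\<^sub>F n in sequentially. ln (u n) < ln (Phi (- K))"
      using ln_u by (simp add: filterlim_at_bot_dense)
    with t u show "\<forall>\<^sub>F n in sequentially. K \<le> t n"
    proof eventually_elim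
      case (elim n)
      hence "Phi (- t n) < Phi (- K)" using Phi_pos[of "- K"] by simp
      thus ?case using Phi_mono[of "- K" "- t n"] by (cases "K \<le> t n") auto
    qed
  qed
  have t_pos: "\<forall>\<^sub>F n in sequentially. 0 < t n"
    using t_top by (simp add: filterlim_at_top_dense)
  have z_top: "filterlim (\<lambda>n. r * t n - b) at_top sequentially"
  proof -
    have "filterlim (\<lambda>x. r * x - b) at_top at_top" using \<open>0 < r\<close> by real_asymp
    from filterlim_compose[OF this t_top] show ?thesis .
  qed
  have z_pos: "\<forall>\<^sub>F n in sequentially. 0 < r * t n - b"
    using z_top unfolding filterlim_at_top_dense by blast
  have Q_t: "(\<lambda>n. ln (Phi (- t n)) / (t n)\<^sup>2) \<longlonglongrightarrow> - 1 / 2"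
    by (rule filterlim_compose[OF ln_Phi_lower_tail t_top])
  have Q_z: "(\<lambda>n. ln (Phi (- (r * t n - b))) / (r * t n - b)\<^sup>2) \<longlonglongrightarrow> - 1 / 2"
    by (rule filterlim_compose[OF ln_Phi_lower_tail z_top])
  have z_t: "(\<lambda>n. (r * t n - b) / t n) \<longlonglongrightarrow> r"
  proof -
    have "((\<lambda>x. (r * x - b) / x) \<longlongrightarrow> r) at_top" using \<open>0 < r\<close> by real_asymp
    from filterlim_compose[OF this t_top] show ?thesis .
  qed
  \<comment> \<open>The rate is a product of known limits: tail over square at \<open>r * t - b\<close>, the squared ratio of
     the two levels, and \<open>(t n)\<^sup>2 / ln n\<close>, the last written through the tail at \<open>t n\<close>.\<close>
  have lim: "(\<lambda>n. ln (Phi (- (r * t n - b))) / (r * t n - b)\<^sup>2 * ((r * t n - b) / t n)\<^sup>2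
      * ((ln (u n) / ln (real n)) / (ln (Phi (- t n)) / (t n)\<^sup>2)))
      \<longlonglongrightarrow> (- 1 / 2) * r\<^sup>2 * (- a / (- 1 / 2))"
    by (intro tendsto_intros Q_z z_t rate Q_t) simp
  have "\<forall>\<^sub>F n in sequentially. ln (Phi (- (r * t n - b))) / (r * t n - b)\<^sup>2 * ((r * t n - b) / t n)\<^sup>2
      * ((ln (u n) / ln (real n)) / (ln (Phi (- t n)) / (t n)\<^sup>2))
      = ln (Phi (- (r * t n - b))) / ln (real n)"
    using t u t_pos z_pos
  proof eventually_elim
    case (elim n)
    hence "ln (u n) < 0" by simp
    thus ?case using elim by (simp add: power_divide)
  qed
  from Lim_transform_eventually[OF lim this]
  have "(\<lambda>n. ln (Phi (- (r * t n - b))) / ln (real n)) \<longlonglongrightarrow> - a * r\<^sup>2"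
    by (simp add: mult.commute)
  with t show ?thesis by (rule that)
qed

section \<open>The probability of few occurrences\<close>

text \<open>
  This is Chernoff's bound, from Markov's inequality for the product of the independent variables
  \<open>exp (- indicator B (X k))\<close>. Each has mean \<open>1 - (1 - exp (- 1)) * u \<le> exp (- u / 2)\<close>.
\<close>

lemma (in prob_space) prob_few_occurrences_le:
  assumes indep: "indep_vars (\<lambda>_. N) X I" and fin: "finite I" and B: "B \<in> sets N"
    and u: "\<And>k. k \<in> I \<Longrightarrow> prob {\<omega> \<in> space M. X k \<omega> \<in> B} = u"
  shows "prob {\<omega> \<in> space M. real (card {k \<in> I. X k \<omega> \<in> B}) \<le> m}
    \<le> exp (m - real (card I) * u / 2)"
proof (cases "I = {}")
  case True
  thus ?thesis by (cases "0 \<le> m") (auto simp: prob_space intro: measure_nonneg)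
next
  case False
  note [measurable] = B
  have X [measurable]: "X k \<in> measurable M N" if "k \<in> I" for k
    using indep that by (auto simp: indep_vars_def)
  define f where "f k \<omega> = exp (- indicator B (X k \<omega>) :: real)" for k \<omega>
  have f [measurable]: "f k \<in> borel_measurable M" if "k \<in> I" for k
    unfolding f_def using X[OF that] by measurable
  have prod_f: "(\<Prod>k\<in>I. f k \<omega>) = exp (- real (card {k \<in> I. X k \<omega> \<in> B}))" for \<omega>
  proof -
    have "(\<Prod>k\<in>I. f k \<omega>) = exp (- (\<Sum>k\<in>I. indicator B (X k \<omega>)))"
      unfolding f_def sum_negf[symmetric] by (rule exp_sum[OF fin, symmetric])
    also have "(\<Sum>k\<in>I. indicator B (X k \<omega>)) = real (card {k \<in> I. X k \<omega> \<in> B})"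
      using fin by (simp add: indicator_def sum.If_cases Int_def)
    finally show ?thesis .
  qed
  have int_f: "integrable M (f k)" if "k \<in> I" for k
    using f[OF that] by (intro integrable_const_bound[where B = 1]) (auto simp: f_def)
  have indep_f: "indep_vars (\<lambda>_. borel) f I"
    unfolding f_def by (rule indep_vars_compose2[OF indep]) measurable
  have exp_f: "expectation (f k) \<le> exp (- u / 2)" if k: "k \<in> I" for k
  proof -
    have f_eq: "f k \<omega> = 1 - (1 - exp (- 1)) * indicator {\<omega> \<in> space M. X k \<omega> \<in> B} \<omega>"
      if "\<omega> \<in> space M" for \<omega>
      using that by (auto simp: f_def indicator_def)
    have ev: "{\<omega> \<in> space M. X k \<omega> \<in> B} \<in> events" using X[OF k] by measurable
    have "expectation (f k)
        = expectation (\<lambda>\<omega>. 1 - (1 - exp (- 1)) * indicator {\<omega> \<in> space M. X k \<omega> \<in> B} \<omega>)"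
      by (intro Bochner_Integration.integral_cong f_eq) auto
    also have "\<dots> = 1 - (1 - exp (- 1)) * u"
      using ev u[OF k]
      by (subst Bochner_Integration.integral_diff) (auto simp: prob_space emeasure_eq_measure intro!: integrable_real_indicator)
    also have "\<dots> \<le> 1 - u / 2"
    proof -
      have "2 \<le> exp (1::real)" using exp_ge_add_one_self[of 1] by simp
      hence "exp (- 1) \<le> (1 / 2 :: real)" by (simp add: exp_minus field_simps)
      moreover have "0 \<le> u" using u[OF k] measure_nonneg by metis
      ultimately have "(1 / 2) * u \<le> (1 - exp (- 1)) * u" by (intro mult_right_mono) auto
      thus ?thesis by simp
    qed
    also have "\<dots> \<le> exp (- u / 2)" using exp_ge_add_one_self[of "- u / 2"] by simp
    finally show ?thesis .
  qed
  have "{\<omega> \<in> space M. real (card {k \<in> I. X k \<omega> \<in> B}) \<le> m}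
      = {\<omega> \<in> space M. exp (- m) \<le> (\<Prod>k\<in>I. f k \<omega>)}"
    by (simp add: prod_f)
  also have "prob \<dots> \<le> expectation (\<lambda>\<omega>. \<Prod>k\<in>I. f k \<omega>) / exp (- m)"
    by (rule integral_Markov_inequality_measure[where A = "{}"])
       (use indep_vars_integrable[OF fin indep_f int_f] in \<open>auto simp: prod_f\<close>)
  also have "expectation (\<lambda>\<omega>. \<Prod>k\<in>I. f k \<omega>) = (\<Prod>k\<in>I. expectation (f k))"
    by (rule indep_vars_lebesgue_integral[OF fin indep_f int_f])
  also have "\<dots> / exp (- m) \<le> (\<Prod>k\<in>I. exp (- u / 2)) / exp (- m)"
    by (intro divide_right_mono prod_mono conjI exp_f) (auto simp: f_def intro!: integral_nonneg)
  also have "\<dots> = exp (m - real (card I) * u / 2)"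
    by (simp add: exp_of_nat_mult[symmetric] exp_diff[symmetric])
  finally show ?thesis .
qed

text \<open>
  Markov's inequality for the number of occurrences inside \<open>A\<close>. Its mean involves each \<open>E k\<close> only
  together with \<open>A\<close>, so independence of \<open>A\<close> from every single \<open>E k\<close> suffices.
\<close>

lemma (in prob_space) prob_few_occurrences_ge:
  assumes "finite I" "A \<in> events" and E: "\<And>k. k \<in> I \<Longrightarrow> E k \<in> events"
    and u: "\<And>k. k \<in> I \<Longrightarrow> prob (A \<inter> E k) = prob A * u"
    and "0 < m"
  shows "prob A * (1 - real (card I) * u / m)
    \<le> prob {\<omega> \<in> A. real (card {k \<in> I. \<omega> \<in> E k}) \<le> m}"
proof -
  note [measurable] = \<open>A \<in> events\<close>
  define S where "S \<omega> = (\<Sum>k\<in>I. indicator (A \<inter> E k) \<omega> :: real)" for \<omega>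
  have int: "integrable M (indicator (A \<inter> E k) :: _ \<Rightarrow> real)" if "k \<in> I" for k
    using sets.Int[OF \<open>A \<in> events\<close> E[OF that]]
    by (intro integrable_real_indicator) (auto simp: emeasure_eq_measure)
  have S_meas [measurable]: "S \<in> borel_measurable M"
    unfolding S_def using E by (intro borel_measurable_sum borel_measurable_indicator) auto
  have S_eq: "S \<omega> = real (card {k \<in> I. \<omega> \<in> E k})" if "\<omega> \<in> A" for \<omega>
    unfolding S_def using that \<open>finite I\<close> by (simp add: indicator_def sum.If_cases Int_def)
  have exp_S: "expectation S = real (card I) * (prob A * u)"
    unfolding S_def using int E u by (subst Bochner_Integration.integral_sum) auto
  have sp: "\<omega> \<in> space M" if "\<omega> \<in> A" for \<omega>
    using sets.sets_into_space[OF \<open>A \<in> events\<close>] that by auto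
  have few: "{\<omega> \<in> A. real (card {k \<in> I. \<omega> \<in> E k}) \<le> m} = A \<inter> {\<omega> \<in> space M. S \<omega> \<le> m}"
    using S_eq sp by auto
  have "prob A \<le> prob ((A \<inter> {\<omega> \<in> space M. S \<omega> \<le> m}) \<union> {\<omega> \<in> space M. m \<le> S \<omega>})"
    using sp by (intro finite_measure_mono) auto
  also have "\<dots> \<le> prob (A \<inter> {\<omega> \<in> space M. S \<omega> \<le> m}) + prob {\<omega> \<in> space M. m \<le> S \<omega>}"
    by (intro measure_Un_le) auto
  also have "prob {\<omega> \<in> space M. m \<le> S \<omega>} \<le> expectation S / m"
    using \<open>0 < m\<close> int
    by (intro integral_Markov_inequality_measure[where A = "{}"])
       (auto simp: S_def sum_nonneg)
  finally have "prob A \<le> prob (A \<inter> {\<omega> \<in> space M. S \<omega> \<le> m}) + real (card I) * (prob A * u) / m"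
    by (simp add: exp_S)
  thus ?thesis unfolding few by (simp add: algebra_simps)
qed

section \<open>The loss of the portfolio\<close>

lemma total_loss_eq:
  "total_loss p \<rho> Z \<epsilon> n \<omega>
    = real n - real (card {k \<in> {1..n}. copula_X \<rho> Z \<epsilon> k \<omega> \<le> - Phi_inv p})"
proof -
  have "total_loss p \<rho> Z \<epsilon> n \<omega>
      = (\<Sum>k=1..n. 1 - of_bool (copula_X \<rho> Z \<epsilon> k \<omega> \<le> - Phi_inv p))"
    unfolding total_loss_def default_indicator_def by (intro sum.cong) auto
  also have "\<dots> = real n - (\<Sum>k=1..n. of_bool (copula_X \<rho> Z \<epsilon> k \<omega> \<le> - Phi_inv p))"
    by (simp add: sum_subtractf)
  also have "(\<Sum>k=1..n. of_bool (copula_X \<rho> Z \<epsilon> k \<omega> \<le> - Phi_inv p))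
      = real (card {k \<in> {1..n}. copula_X \<rho> Z \<epsilon> k \<omega> \<le> - Phi_inv p})"
    by (simp add: of_bool_def sum.If_cases Int_def)
  finally show ?thesis .
qed

lemma total_loss_ge_iff:
  "real n * q \<le> total_loss p \<rho> Z \<epsilon> n \<omega>
    \<longleftrightarrow> real (card {k \<in> {1..n}. copula_X \<rho> Z \<epsilon> k \<omega> \<le> - Phi_inv p}) \<le> real n * (1 - q)"
  unfolding total_loss_eq right_diff_distrib mult_1_right by linarith

lemma factor_familyD:
  assumes "factor_family M Z \<epsilon>"
  shows "distributed M lborel Z std_normal_density"
    and "k \<ge> 1 \<Longrightarrow> distributed M lborel (\<epsilon> k) std_normal_density"
    and "Z \<in> borel_measurable M"
    and "k \<ge> 1 \<Longrightarrow> \<epsilon> k \<in> borel_measurable M"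
proof -
  show *: "distributed M lborel (\<epsilon> k) std_normal_density" if "k \<ge> 1"
    using assms that unfolding factor_family_def by auto
  show Z: "distributed M lborel Z std_normal_density"
    using assms unfolding factor_family_def by auto
  show "Z \<in> borel_measurable M" using distributed_measurable[OF Z] by simp
  show "\<epsilon> k \<in> borel_measurable M" if "k \<ge> 1" using distributed_measurable[OF *[OF that]] by simp
qed

lemma card_event_measurable:
  assumes "finite I" "\<And>k. k \<in> I \<Longrightarrow> X k \<in> borel_measurable M"
  shows "{\<omega> \<in> space M. real (card {k \<in> I. X k \<omega> \<in> {..s::real}}) \<le> m} \<in> sets M"
proof -
  have [measurable]: "X k \<in> borel_measurable M" if "k \<in> I" for k using assms that by auto
  have *: "real (card {k \<in> I. X k \<omega> \<in> {..s}}) = (\<Sum>k\<in>I. indicator {..s} (X k \<omega>))" for \<omega>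
    using assms(1) by (simp add: indicator_def sum.If_cases Int_def)
  show ?thesis unfolding * by measurable
qed

lemma total_loss_event_measurable:
  assumes ff: "factor_family M Z \<epsilon>"
  shows "{\<omega> \<in> space M. real n * q \<le> total_loss p \<rho> Z \<epsilon> n \<omega>} \<in> sets M"
proof -
  have "copula_X \<rho> Z \<epsilon> k \<in> borel_measurable M" if "k \<in> {1..n}" for k
  proof -
    have [measurable]: "Z \<in> borel_measurable M" "\<epsilon> k \<in> borel_measurable M"
      using factor_familyD[OF ff] that by auto
    show ?thesis unfolding copula_X_def[abs_def] by measurable
  qed
  hence "{\<omega> \<in> space M. real (card {k \<in> {1..n}. copula_X \<rho> Z \<epsilon> k \<omega> \<in> {..- Phi_inv p}})
      \<le> real n * (1 - q)} \<in> sets M"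
    by (intro card_event_measurable) simp_all
  thus ?thesis unfolding total_loss_ge_iff atMost_iff .
qed

text \<open>
  At the level \<open>z\<close> of the common factor, survival is exactly \<open>\<epsilon> k \<le> - t\<close>. Since \<open>copula_X\<close> increases
  with \<open>Z\<close>, one implication persists above \<open>z\<close> and the other one below.
\<close>

lemma copula_X_le_threshold:
  assumes "0 < \<rho>" "\<rho> < 1"
    and z: "z = sqrt (1 - \<rho>\<^sup>2) / \<rho> * t - c / \<rho>"
  shows "z \<le> Z \<omega> \<Longrightarrow> copula_X \<rho> Z \<epsilon> k \<omega> \<le> - c \<Longrightarrow> \<epsilon> k \<omega> \<le> - t"
    and "Z \<omega> \<le> z \<Longrightarrow> \<epsilon> k \<omega> \<le> - t \<Longrightarrow> copula_X \<rho> Z \<epsilon> k \<omega> \<le> - c"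
proof -
  define \<sigma> where "\<sigma> = sqrt (1 - \<rho>\<^sup>2)"
  have \<sigma>: "0 < \<sigma>" unfolding \<sigma>_def using assms by (simp add: power_less_one_iff)
  have \<rho>z: "\<rho> * z = \<sigma> * t - c" using assms by (simp add: z \<sigma>_def field_simps)
  {
    assume "z \<le> Z \<omega>" and X: "copula_X \<rho> Z \<epsilon> k \<omega> \<le> - c"
    hence "\<rho> * z \<le> \<rho> * Z \<omega>" using assms by simp
    hence "\<sigma> * \<epsilon> k \<omega> \<le> \<sigma> * (- t)" using X \<rho>z by (simp add: copula_X_def \<sigma>_def)
    thus "\<epsilon> k \<omega> \<le> - t" using \<sigma> by (simp only: mult_le_cancel_left_pos)
  next
    assume "Z \<omega> \<le> z" and "\<epsilon> k \<omega> \<le> - t"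
    hence "\<rho> * Z \<omega> \<le> \<rho> * z" "\<sigma> * \<epsilon> k \<omega> \<le> \<sigma> * (- t)" using assms \<sigma> by (simp_all only: mult_le_cancel_left_pos)
    thus "copula_X \<rho> Z \<epsilon> k \<omega> \<le> - c" using \<rho>z by (simp add: copula_X_def \<sigma>_def)
  }
qed

text \<open>
  The two bounds below hold for every \<open>t\<close>; the asymptotics come from the choice of \<open>t\<close>. In the lower
  bound, \<open>{Z \<ge> z}\<close> is independent of each event \<open>\<epsilon> k \<le> - t\<close>, and the survivors are among the indices
  where it occurs. In the upper bound, \<open>Z < z\<close> forces all of those indices to survive.
\<close>

lemma prob_total_loss_ge:
  assumes "prob_space M" and ff: "factor_family M Z \<epsilon>" and \<rho>: "0 < \<rho>" "\<rho> < 1"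
    and q: "0 < n" "q < 1"
  shows "Phi (- (sqrt (1 - \<rho>\<^sup>2) / \<rho> * t - Phi_inv p / \<rho>)) * (1 - Phi (- t) / (1 - q))
    \<le> measure M {\<omega> \<in> space M. real n * q \<le> total_loss p \<rho> Z \<epsilon> n \<omega>}"
proof -
  interpret prob_space M by fact
  note [measurable] = factor_familyD(3)[OF ff]
  define z where "z = sqrt (1 - \<rho>\<^sup>2) / \<rho> * t - Phi_inv p / \<rho>"
  define A where "A = {\<omega> \<in> space M. z \<le> Z \<omega>}"
  define E where "E k = {\<omega> \<in> space M. \<epsilon> k \<omega> \<le> - t}" for k
  have A [measurable]: "A \<in> events" unfolding A_def by measurable
  have E [measurable]: "E k \<in> events" if "k \<in> {1..n}" for k
    unfolding E_def using factor_familyD(4)[OF ff, of k] that by simp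
  have prob_A: "prob A = Phi (- z)"
    unfolding A_def by (rule Phi_minus_eq_prob[OF assms(1) factor_familyD(1)[OF ff]])
  have prob_E: "prob (E k) = Phi (- t)" if "k \<in> {1..n}" for k
    unfolding E_def using that by (intro Phi_eq_prob[OF assms(1)] factor_familyD(2)[OF ff]) auto
  have prob_AE: "prob (A \<inter> E k) = prob A * Phi (- t)" if k: "k \<in> {1..n}" for k
  proof -
    define W where "W j = (if j = 0 then Z else \<epsilon> j)" for j
    define D where "D j = (if j = 0 then {z..} else {..- t})" for j :: nat
    have "indep_vars (\<lambda>_. borel) W UNIV"
      using ff unfolding factor_family_def W_def by auto
    from indep_varsD[OF this, of "{0, k}" D]
    have *: "prob (\<Inter>j\<in>{0, k}. W j -` D j \<inter> space M) = (\<Prod>j\<in>{0, k}. prob (W j -` D j \<inter> space M))"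
      by (simp add: D_def)
    have "W 0 -` D 0 \<inter> space M = A" "W k -` D k \<inter> space M = E k"
      using k by (auto simp: W_def D_def A_def E_def)
    with * k have "prob (A \<inter> E k) = prob A * prob (E k)" by simp
    thus ?thesis using prob_E[OF k] by simp
  qed
  have "Phi (- z) * (1 - Phi (- t) / (1 - q))
      = prob A * (1 - real (card {1..n}) * Phi (- t) / (real n * (1 - q)))"
    using q by (simp add: prob_A)
  also have "\<dots> \<le> prob {\<omega> \<in> A. real (card {k \<in> {1..n}. \<omega> \<in> E k}) \<le> real n * (1 - q)}"
    using q by (intro prob_few_occurrences_ge prob_AE A E) auto
  also have "\<dots> \<le> prob {\<omega> \<in> space M. real n * q \<le> total_loss p \<rho> Z \<epsilon> n \<omega>}"
  proof (rule finite_measure_mono)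
    show "{\<omega> \<in> A. real (card {k \<in> {1..n}. \<omega> \<in> E k}) \<le> real n * (1 - q)}
        \<subseteq> {\<omega> \<in> space M. real n * q \<le> total_loss p \<rho> Z \<epsilon> n \<omega>}"
    proof
      fix \<omega> assume "\<omega> \<in> {\<omega> \<in> A. real (card {k \<in> {1..n}. \<omega> \<in> E k}) \<le> real n * (1 - q)}"
      hence \<omega>: "\<omega> \<in> space M" "z \<le> Z \<omega>"
        and few: "real (card {k \<in> {1..n}. \<omega> \<in> E k}) \<le> real n * (1 - q)"
        by (auto simp: A_def)
      have "card {k \<in> {1..n}. copula_X \<rho> Z \<epsilon> k \<omega> \<le> - Phi_inv p} \<le> card {k \<in> {1..n}. \<omega> \<in> E k}"
        using \<omega> copula_X_le_threshold(1)[OF \<rho> z_def, of Z \<omega> \<epsilon>] by (intro card_mono) (auto simp: E_def)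
      with few have "real n * q \<le> total_loss p \<rho> Z \<epsilon> n \<omega>"
        unfolding total_loss_ge_iff by linarith
      with \<omega> show "\<omega> \<in> {\<omega> \<in> space M. real n * q \<le> total_loss p \<rho> Z \<epsilon> n \<omega>}" by simp
    qed
    show "{\<omega> \<in> space M. real n * q \<le> total_loss p \<rho> Z \<epsilon> n \<omega>} \<in> events"
      by (intro total_loss_event_measurable ff)
  qed
  finally show ?thesis unfolding z_def .
qed

lemma prob_total_loss_le:
  assumes "prob_space M" and ff: "factor_family M Z \<epsilon>" and \<rho>: "0 < \<rho>" "\<rho> < 1"
  shows "measure M {\<omega> \<in> space M. real n * q \<le> total_loss p \<rho> Z \<epsilon> n \<omega>}
    \<le> Phi (- (sqrt (1 - \<rho>\<^sup>2) / \<rho> * t - Phi_inv p / \<rho>))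
      + exp (real n * (1 - q) - real n * Phi (- t) / 2)"
proof -
  interpret prob_space M by fact
  note [measurable] = factor_familyD(3)[OF ff]
  define z where "z = sqrt (1 - \<rho>\<^sup>2) / \<rho> * t - Phi_inv p / \<rho>"
  define A where "A = {\<omega> \<in> space M. z \<le> Z \<omega>}"
  define F where "F = {\<omega> \<in> space M. real (card {k \<in> {1..n}. \<epsilon> k \<omega> \<in> {..- t}}) \<le> real n * (1 - q)}"
  have A: "A \<in> events" unfolding A_def by measurable
  have F: "F \<in> events"
    unfolding F_def by (intro card_event_measurable) (use factor_familyD(4)[OF ff] in auto)
  have prob_A: "prob A = Phi (- z)"
    unfolding A_def by (rule Phi_minus_eq_prob[OF assms(1) factor_familyD(1)[OF ff]])
  have indep: "indep_vars (\<lambda>_. borel) \<epsilon> {1..n}"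
  proof -
    have "indep_vars (\<lambda>_. borel) (\<lambda>k. if k = 0 then Z else \<epsilon> k) {1..n}"
      using ff unfolding factor_family_def by (blast intro: indep_vars_subset)
    thus ?thesis by (subst (asm) indep_vars_cong[of _ "{1..n}" _ \<epsilon> _ "\<lambda>_. borel"]) auto
  qed
  have "prob F \<le> exp (real n * (1 - q) - real (card {1..n}) * Phi (- t) / 2)"
    unfolding F_def
  proof (rule prob_few_occurrences_le[OF indep])
    show "prob {\<omega> \<in> space M. \<epsilon> k \<omega> \<in> {..- t}} = Phi (- t)" if "k \<in> {1..n}" for k
      using Phi_eq_prob[OF assms(1) factor_familyD(2)[OF ff], of k "- t"] that by simp
  qed auto
  hence prob_F: "prob F \<le> exp (real n * (1 - q) - real n * Phi (- t) / 2)" by simp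
  have "{\<omega> \<in> space M. real n * q \<le> total_loss p \<rho> Z \<epsilon> n \<omega>} \<subseteq> A \<union> F"
  proof
    fix \<omega> assume "\<omega> \<in> {\<omega> \<in> space M. real n * q \<le> total_loss p \<rho> Z \<epsilon> n \<omega>}"
    hence \<omega>: "\<omega> \<in> space M"
      and few: "real (card {k \<in> {1..n}. copula_X \<rho> Z \<epsilon> k \<omega> \<le> - Phi_inv p}) \<le> real n * (1 - q)"
      by (auto simp: total_loss_ge_iff)
    show "\<omega> \<in> A \<union> F"
    proof (cases "z \<le> Z \<omega>")
      case False
      have "card {k \<in> {1..n}. \<epsilon> k \<omega> \<in> {..- t}}
          \<le> card {k \<in> {1..n}. copula_X \<rho> Z \<epsilon> k \<omega> \<le> - Phi_inv p}"
        using False copula_X_le_threshold(2)[OF \<rho> z_def, of Z \<omega> \<epsilon>] by (intro card_mono) auto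
      with few \<omega> show ?thesis unfolding F_def by auto
    qed (use \<omega> in \<open>simp add: A_def\<close>)
  qed
  hence "prob {\<omega> \<in> space M. real n * q \<le> total_loss p \<rho> Z \<epsilon> n \<omega>} \<le> prob (A \<union> F)"
    using A F by (intro finite_measure_mono) auto
  also have "\<dots> \<le> prob A + prob F" using A F by (rule measure_Un_le)
  finally show ?thesis using prob_F unfolding prob_A z_def by linarith
qed

section \<open>The decay exponent\<close>

theorem theorem5p1:
  fixes M :: "'a measure" and Z :: "'a \<Rightarrow> real" and \<epsilon> :: "nat \<Rightarrow> 'a \<Rightarrow> real"
    and p \<rho> a :: real and q :: "nat \<Rightarrow> real"
  assumes "prob_space M"
    and "factor_family M Z \<epsilon>"
    and "0 < p" "p < 1"
    and "0 < \<rho>" "\<rho> < 1"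
    and "0 < a" "a \<le> 1"
    and "\<forall>n\<ge>1. q n < 1"
    and "mono_on {1..} q"
    and "q \<longlonglongrightarrow> 1"
    and "\<exists>c C. 0 < c \<and> c \<le> C \<and>
           (\<forall>\<^sub>F n in sequentially.
              c * real n powr (- a) \<le> 1 - q n \<and> 1 - q n \<le> C * real n powr (- a))"
  shows "(\<lambda>n. 1 / ln (real n) *
            ln (measure M {\<omega> \<in> space M. total_loss p \<rho> Z \<epsilon> n \<omega> \<ge> real n * q n}))
         \<longlonglongrightarrow> - a * ((1 - \<rho>\<^sup>2) / \<rho>\<^sup>2)"
proof -
  define P where "P n = measure M {\<omega> \<in> space M. real n * q n \<le> total_loss p \<rho> Z \<epsilon> n \<omega>}" for n
  define r where "r = sqrt (1 - \<rho>\<^sup>2) / \<rho>"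
  define b where "b = Phi_inv p / \<rho>"
  have \<rho>: "0 < \<rho>" "\<rho> < 1" by fact+
  have \<rho>2: "\<rho>\<^sup>2 < 1" using \<rho> by (simp add: power_less_one_iff)
  have "0 < r" unfolding r_def using \<rho> \<rho>2 by simp
  have r2: "r\<^sup>2 = (1 - \<rho>\<^sup>2) / \<rho>\<^sup>2" unfolding r_def using \<rho>2 by (simp add: power_divide)
  define L where "L = a * r\<^sup>2"
  have "0 < L" unfolding L_def using \<open>0 < a\<close> \<open>0 < r\<close> by simp
  obtain c C where cC: "0 < c" "c \<le> C"
    and q: "\<forall>\<^sub>F n in sequentially. c * real n powr (- a) \<le> 1 - q n \<and> 1 - q n \<le> C * real n powr (- a)"
    using assms(12) by (elim exE conjE)
  define d where "d n = 1 - q n" for n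
  have d_pos: "\<forall>\<^sub>F n in sequentially. 0 < d n"
    using eventually_ge_at_top[of 1] by eventually_elim (use assms(9) in \<open>simp add: d_def\<close>)
  have d_lim: "d \<longlonglongrightarrow> 0"
    using tendsto_diff[OF tendsto_const assms(11), of 1] by (simp add: d_def[abs_def])

  have d_rate: "(\<lambda>n. ln (d n) / ln (real n)) \<longlonglongrightarrow> - a"
  proof (rule tendsto_sandwich)
    have "\<forall>\<^sub>F n in sequentially. ln c - a * ln (real n) \<le> ln (d n)
        \<and> ln (d n) \<le> ln C - a * ln (real n)"
      using q d_pos eventually_gt_at_top[of 0]
    proof eventually_elim
      case (elim n)
      have "ln (c * real n powr (- a)) \<le> ln (d n)" "ln (d n) \<le> ln (C * real n powr (- a))"
        using elim cC by (simp_all add: d_def)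
      thus ?case using elim cC by (simp add: ln_mult ln_powr)
    qed
    hence ev: "\<forall>\<^sub>F n in sequentially. (ln c - a * ln (real n)) / ln (real n) \<le> ln (d n) / ln (real n)
        \<and> ln (d n) / ln (real n) \<le> (ln C - a * ln (real n)) / ln (real n)"
      using eventually_gt_at_top[of 1] by eventually_elim (simp add: divide_right_mono)
    from ev show "\<forall>\<^sub>F n in sequentially. (ln c - a * ln (real n)) / ln (real n) \<le> ln (d n) / ln (real n)"
      by eventually_elim simp
    from ev show "\<forall>\<^sub>F n in sequentially. ln (d n) / ln (real n) \<le> (ln C - a * ln (real n)) / ln (real n)"
      by eventually_elim simp
    show "(\<lambda>n. (ln c - a * ln (real n)) / ln (real n)) \<longlonglongrightarrow> - a" by real_asymp
    show "(\<lambda>n. (ln C - a * ln (real n)) / ln (real n)) \<longlonglongrightarrow> - a" by real_asymp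
  qed

  \<comment> \<open>Half of the tolerated proportion of survivors makes Markov's inequality lose a factor \<open>2\<close> only.\<close>
  have u_rate: "(\<lambda>n. ln (1 / 2 * d n) / ln (real n)) \<longlonglongrightarrow> - a"
    using d_pos d_rate by (intro ln_rate_cmult) auto
  have d_lt_2: "\<forall>\<^sub>F n in sequentially. d n < 2"
    by (rule order_tendstoD(2)[OF d_lim]) simp
  have u_ev: "\<forall>\<^sub>F n in sequentially. 0 < 1 / 2 * d n \<and> 1 / 2 * d n < 1"
    using d_pos d_lt_2 by eventually_elim simp
  obtain t where t: "\<forall>\<^sub>F n in sequentially. Phi (- t n) = 1 / 2 * d n"
    and A_rate: "(\<lambda>n. ln (Phi (- (r * t n - b))) / ln (real n)) \<longlonglongrightarrow> - a * r\<^sup>2"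
    by (rule ln_rate_Phi_affine_quantile[OF u_ev u_rate \<open>0 < a\<close> \<open>0 < r\<close>])
  have lower: "\<forall>\<^sub>F n in sequentially. 1 / 2 * Phi (- (r * t n - b)) \<le> P n"
    using t d_pos eventually_gt_at_top[of 0]
  proof eventually_elim
    case (elim n)
    have "Phi (- (r * t n - b)) * (1 - Phi (- t n) / (1 - q n)) \<le> P n"
      unfolding r_def b_def P_def using elim
      by (intro prob_total_loss_ge assms) (simp_all add: d_def)
    moreover have "Phi (- t n) / (1 - q n) = 1 / 2" using elim by (simp add: d_def)
    ultimately show ?case by simp
  qed
  have lower_rate: "(\<lambda>n. ln (1 / 2 * Phi (- (r * t n - b))) / ln (real n)) \<longlonglongrightarrow> - a * r\<^sup>2"
    by (intro ln_rate_cmult A_rate) (simp_all add: Phi_pos)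

  \<comment> \<open>The factor \<open>(ln n)\<^sup>2\<close> is large enough to make the Chernoff term smaller than every power of \<open>n\<close>,
     and small enough to leave the logarithmic rate \<open>- a\<close> unchanged.\<close>
  define v where "v n = real n powr (- a) * (ln (real n))\<^sup>2" for n :: nat
  have v_rate: "(\<lambda>n. ln (v n) / ln (real n)) \<longlonglongrightarrow> - a"
    unfolding v_def using \<open>0 < a\<close> by real_asymp
  have v_ev: "\<forall>\<^sub>F n in sequentially. 0 < v n \<and> v n < 1"
  proof -
    have "v \<longlonglongrightarrow> 0" unfolding v_def using \<open>0 < a\<close> by real_asymp
    hence "\<forall>\<^sub>F n in sequentially. v n < 1" by (rule order_tendstoD) simp
    thus ?thesis using eventually_gt_at_top[of 1]
      by eventually_elim (simp add: v_def)
  qed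
  obtain s where s: "\<forall>\<^sub>F n in sequentially. Phi (- s n) = v n"
    and B_rate: "(\<lambda>n. ln (Phi (- (r * s n - b))) / ln (real n)) \<longlonglongrightarrow> - a * r\<^sup>2"
    by (rule ln_rate_Phi_affine_quantile[OF v_ev v_rate \<open>0 < a\<close> \<open>0 < r\<close>])
  \<comment> \<open>The factor tail is eventually at least \<open>n powr (- (L + 1))\<close>, hence dominates the Chernoff term.\<close>
  have "\<forall>\<^sub>F n in sequentially. - (L + 1) < ln (Phi (- (r * s n - b))) / ln (real n)"
    by (rule order_tendstoD(1)[OF B_rate]) (simp add: L_def)
  moreover have "\<forall>\<^sub>F n in sequentially. C - (ln (real n))\<^sup>2 / 2 \<le> - (L + 1) * ln (real n)"
    by real_asymp
  ultimately have upper: "\<forall>\<^sub>F n in sequentially. P n \<le> 2 * Phi (- (r * s n - b))"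
    using s q eventually_gt_at_top[of 1]
  proof eventually_elim
    case (elim n)
    let ?A = "Phi (- (r * s n - b))"
    have ln_pos: "0 < ln (real n)" using elim by simp
    have n_powr: "real n * real n powr (- a) = real n powr (1 - a)"
      using elim by (simp add: powr_diff powr_minus field_simps)
    \<comment> \<open>This is where \<open>a \<le> 1\<close> enters: the Chernoff exponent is at least of order \<open>(ln n)\<^sup>2\<close>.\<close>
    have ge1: "1 \<le> real n powr (1 - a)" using elim \<open>a \<le> 1\<close> by (simp add: ge_one_powr_ge_zero)
    have "real n * (1 - q n) - real n * Phi (- s n) / 2
        \<le> real n * (C * real n powr (- a)) - real n * (real n powr (- a) * (ln (real n))\<^sup>2) / 2"
      using elim by (simp add: v_def mult_left_mono)
    also have "\<dots> = (real n * real n powr (- a)) * (C - (ln (real n))\<^sup>2 / 2)"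
      by (simp add: algebra_simps)
    also have "\<dots> \<le> real n powr (1 - a) * (- (L + 1) * ln (real n))"
      unfolding n_powr using elim by (intro mult_left_mono) auto
    also have "\<dots> \<le> 1 * (- (L + 1) * ln (real n))"
      using ge1 ln_pos \<open>0 < L\<close> by (intro mult_right_mono_neg mult_nonpos_nonneg) auto
    also have "\<dots> \<le> ln ?A" using elim(1) ln_pos by (simp add: pos_less_divide_eq)
    finally have "exp (real n * (1 - q n) - real n * Phi (- s n) / 2) \<le> ?A"
      using Phi_pos by (simp add: ln_ge_iff)
    moreover have "P n \<le> ?A + exp (real n * (1 - q n) - real n * Phi (- s n) / 2)"
      unfolding r_def b_def P_def by (intro prob_total_loss_le assms)
    ultimately show ?case by simp
  qed
  have upper_rate: "(\<lambda>n. ln (2 * Phi (- (r * s n - b))) / ln (real n)) \<longlonglongrightarrow> - a * r\<^sup>2"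
    by (intro ln_rate_cmult B_rate) (simp_all add: Phi_pos)

  have "(\<lambda>n. ln (P n) / ln (real n)) \<longlonglongrightarrow> - a * r\<^sup>2"
  proof (rule tendsto_sandwich[OF _ _ lower_rate upper_rate])
    show "\<forall>\<^sub>F n in sequentially. ln (1 / 2 * Phi (- (r * t n - b))) / ln (real n) \<le> ln (P n) / ln (real n)"
      using lower eventually_gt_at_top[of 1]
    proof eventually_elim
      case (elim n)
      moreover have "0 < 1 / 2 * Phi (- (r * t n - b))" by (simp add: Phi_pos)
      ultimately have "ln (1 / 2 * Phi (- (r * t n - b))) \<le> ln (P n)" by (intro ln_mono) auto
      thus ?case using elim by (intro divide_right_mono) auto
    qed
    show "\<forall>\<^sub>F n in sequentially. ln (P n) / ln (real n) \<le> ln (2 * Phi (- (r * s n - b))) / ln (real n)"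
      using lower upper eventually_gt_at_top[of 1]
    proof eventually_elim
      case (elim n)
      have "0 < P n" using elim(1) Phi_pos[of "- (r * t n - b)"] by linarith
      hence "ln (P n) \<le> ln (2 * Phi (- (r * s n - b)))" using elim by (intro ln_mono) auto
      thus ?case using elim by (intro divide_right_mono) auto
    qed
  qed
  thus ?thesis unfolding P_def r2 by simp
qed

end
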